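(* Define, for positive integers $x,y,z\ge 1$, the polynomials \[ p_1(x,y,z)=x(4yz-1)-yz,\quad p_2(x,y,z)=x(4yz-z-1)-yz,\quad p_3(x,y,z)=x(8y-3)-6y+2,\quad p_4(x,y,z)=x^2-x. \] Assume that every positive integer $q\ge 1$ equals $p_i(x,y,z)$ for some $i\in\{1,2,3,4\}$ and some positive integers $x,y,z$. Then every prime number of the form $4q+1$ with $q\ge 1$ can be written as $4p_2(x,y,z)+1$ for some positive integers $x,y,z$.
   Context: The variables $x,y,z$ range over the positive integers. *)

theory Defs
  imports "HOL-Computational_Algebra.Primes"
begin

text \<open>The polynomials have integer coefficients and involve genuine subtraction, so they are
  stated over the integers; positivity of the arguments is imposed where they are used.
  All four take three arguments, although p3 and p4 do not depend on all of them.\<close>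

definition p1 :: "int \<Rightarrow> int \<Rightarrow> int \<Rightarrow> int" where
  "p1 x y z = x * (4 * y * z - 1) - y * z"

definition p2 :: "int \<Rightarrow> int \<Rightarrow> int \<Rightarrow> int" where
  "p2 x y z = x * (4 * y * z - z - 1) - y * z"

definition p3 :: "int \<Rightarrow> int \<Rightarrow> int \<Rightarrow> int" where
  "p3 x y z = x * (8 * y - 3) - 6 * y + 2"

definition p4 :: "int \<Rightarrow> int \<Rightarrow> int \<Rightarrow> int" where
  "p4 x y z = x\<^sup>2 - x"

end

theory Submission imports Defs begin

text \<open>The values \<open>4 p\<^sub>i + 1\<close> for \<open>i = 1, 3, 4\<close> factor. For \<open>i = 1\<close> and \<open>i = 4\<close> the result is never
  prime; for \<open>i = 3\<close> it is prime only if \<open>x = 1\<close>, and then \<open>p\<^sub>3(1, y, z) = 2y - 1 = p\<^sub>2(y, 1, 1)\<close>.\<close>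

lemma four_p1_plus_1: "4 * p1 x y z + 1 = (4 * x - 1) * (4 * (y * z) - 1)"
  by (simp add: p1_def algebra_simps)

lemma four_p3_plus_1: "4 * p3 x y z + 1 = (4 * x - 3) * (8 * y - 3)"
  by (simp add: p3_def algebra_simps)

lemma four_p4_plus_1: "4 * p4 x y z + 1 = (2 * x - 1) * (2 * x - 1)"
  by (simp add: p4_def algebra_simps power2_eq_square)

text \<open>A prime is irreducible, so one factor is a unit of the integers, that is 1 or -1; the
  lower bounds exclude -1.\<close>

lemma prime_int_mult_cases:
  fixes a b :: int
  assumes "prime (a * b)" and "a \<ge> 1" and "b \<ge> 1"
  shows "a = 1 \<or> b = 1"
proof -
  have "is_unit a \<or> is_unit b"
    using assms(1) prime_elem_imp_irreducible prime_imp_prime_elem irreducibleD by blast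
  then show ?thesis using assms(2,3) by (simp add: zdvd1_eq)
qed

theorem theorem3:
  assumes "\<forall>q::int. q \<ge> 1 \<longrightarrow>
    (\<exists>f\<in>{p1, p2, p3, p4}. \<exists>x y z :: int. x \<ge> 1 \<and> y \<ge> 1 \<and> z \<ge> 1 \<and> q = f x y z)"
  shows "\<forall>r::int. prime r \<and> (\<exists>q::int. q \<ge> 1 \<and> r = 4 * q + 1) \<longrightarrow>
    (\<exists>x y z :: int. x \<ge> 1 \<and> y \<ge> 1 \<and> z \<ge> 1 \<and> r = 4 * p2 x y z + 1)"
proof (intro allI impI, elim conjE exE)
  fix r q :: int
  assume r: "prime r" "r = 4 * q + 1" and "q \<ge> 1"
  with assms obtain f x y z where f: "f \<in> {p1, p2, p3, p4}"
    and pos: "x \<ge> 1" "y \<ge> 1" "z \<ge> 1" and q: "q = f x y z"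
    by meson
  from f consider "f = p1" | "f = p2" | "f = p3" | "f = p4" by blast
  then show "\<exists>x y z :: int. x \<ge> 1 \<and> y \<ge> 1 \<and> z \<ge> 1 \<and> r = 4 * p2 x y z + 1"
  proof cases
    case 1
    have "y * z \<ge> 1" using mult_mono[of 1 y 1 z] pos by simp
    moreover have "prime ((4 * x - 1) * (4 * (y * z) - 1))"
      using r q 1 by (simp add: four_p1_plus_1)
    ultimately have "4 * x - 1 = 1 \<or> 4 * (y * z) - 1 = 1"
      using pos by (intro prime_int_mult_cases) auto
    \<comment> \<open>Both factors are congruent to 3 modulo 4, so neither can be 1.\<close>
    then have False by presburger
    then show ?thesis ..
  next
    case 2
    then show ?thesis using r q pos by blast
  next
    case 3
    have "prime ((4 * x - 3) * (8 * y - 3))"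
      using r q 3 by (simp add: four_p3_plus_1)
    then have "4 * x - 3 = 1 \<or> 8 * y - 3 = 1"
      using pos by (intro prime_int_mult_cases) auto
    \<comment> \<open>The alternative \<open>8 * y - 3 = 1\<close> would give
      \<open>8 * y = 4\<close>, which has no integer solution.\<close>
    then have "x = 1" by presburger
    then have "r = 4 * p2 y 1 1 + 1"
      using r q 3 by (simp add: p3_def p2_def)
    then show ?thesis using pos by (intro exI[of _ y] exI[of _ 1]) simp
  next
    case 4
    have "prime ((2 * x - 1) * (2 * x - 1))"
      using r q 4 by (simp add: four_p4_plus_1)
    \<comment> \<open>With equal factors both alternatives say the same, so the supposed prime is
      \<open>1 * 1\<close>, a contradiction.\<close>
    moreover from this have "2 * x - 1 = 1"
      using prime_int_mult_cases[of "2 * x - 1" "2 * x - 1"] pos by simp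
    ultimately show ?thesis by simp
  qed
qed

end
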